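(* Let $\mu,\nu>0$ with $\mu+\nu=1$, let $N$ and $C_N$ be integers with $1\le C_N\le N$, and let $(X_N(t))_{t\ge0}$ be the Engset process with $N$ sources, capacity $C_N$ and parameters $\nu,\mu$. For $\alpha>0$ define $$b_N(\alpha)=\nu\int_0^1(1-u)^{C_N}\left(1+\frac{\nu}{\mu}u\right)^{N-C_N-1}u^\alpha\,du,\qquad d_N(\alpha)=\mu\int_0^1(1-u)^{N-C_N-1}\left(1+\frac{\mu}{\nu}u\right)^{C_N}u^\alpha\,du,$$ and, for $t\ge0$, $$I_\alpha^N(t)=e^{-\alpha t}\int_0^1(1-u)^{X_N(t)}\left(1+\frac{\nu}{\mu}u\right)^{N-X_N(t)}u^{\alpha-1}\,du,$$ $$J_\alpha^N(t)=e^{-\alpha t}\int_0^1(1-u)^{N-X_N(t)}\left(1+\frac{\mu}{\nu}u\right)^{X_N(t)}u^{\alpha-1}\,du,$$ $$K_\alpha^N(t)=d_N(\alpha)I_\alpha^N(t)+b_N(\alpha)J_\alpha^N(t).$$ If $T_0^{X_N}=\inf\{s\ge0:X_N(s)=0\}$ is the hitting time of $0$ by $(X_N(t))$, then the process $\left(K_\alpha^N(t\wedge T_0^{X_N})\right)_{t\ge0}$ is a martingale.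
   Context: The Engset process $(X_N(t))_{t\ge0}$ with $N$ sources, capacity $C_N$ ($1\le C_N\le N$) and parameters $\nu,\mu>0$ is the continuous-time birth and death Markov process on $\{0,1,\ldots,C_N\}$ with transition rates $q(x,x-1)=\mu x$ for $0\le x\le C_N$ and $q(x,x+1)=\nu(N-x)$ for $0\le x<C_N$ (no upward jump from $C_N$). The time scale is normalized so that $\mu+\nu=1$. Martingales are with respect to the natural filtration of $(X_N(t))$. Notation: $a\wedge b=\min(a,b)$.
   Formalization: The formal statement assumes C_N < N instead of C_N ≤ N: for C_N = N the integral d_N(α) contains 1/(1-u) and diverges, so K is identically +∞ and the martingale claim has no meaning. *)

theory Defs
  imports "HOL-Probability.Probability"
begin

section \<open>Martingales in continuous time\<close>

definition natural_filtration :: "'a measure \<Rightarrow> (real \<Rightarrow> 'a \<Rightarrow> 'b) \<Rightarrow> real \<Rightarrow> 'a measure" where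
  "natural_filtration M X t =
     sigma (space M) {X s -` A \<inter> space M | s A. 0 \<le> s \<and> s \<le> t}"

(* The preimages of all subsets A are taken, so the definition above is meant for
   processes with values in a countable discrete state space only. *)

definition martingale :: "'a measure \<Rightarrow> (real \<Rightarrow> 'a measure) \<Rightarrow> (real \<Rightarrow> 'a \<Rightarrow> real) \<Rightarrow> bool" where
  "martingale M F Z \<longleftrightarrow>
     filtration (space M) F \<and> (\<forall>t\<ge>0. subalgebra M (F t)) \<and>
     (\<forall>t\<ge>0. Z t \<in> borel_measurable (F t)) \<and>
     (\<forall>t\<ge>0. integrable M (Z t)) \<and>
     (\<forall>s t. 0 \<le> s \<and> s \<le> t \<longrightarrow> (AE \<omega> in M. real_cond_exp M (F s) (Z t) \<omega> = Z s \<omega>))"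


section \<open>Markov processes on a finite state space\<close>

definition transition_function :: "'s set \<Rightarrow> (real \<Rightarrow> 's \<Rightarrow> 's \<Rightarrow> real) \<Rightarrow> bool" where
  "transition_function E p \<longleftrightarrow>
     (\<forall>t\<ge>0. \<forall>x\<in>E. (\<forall>y\<in>E. 0 \<le> p t x y) \<and> (\<Sum>y\<in>E. p t x y) = 1) \<and>
     (\<forall>x\<in>E. \<forall>y\<in>E. p 0 x y = (if x = y then 1 else 0)) \<and>
     (\<forall>s\<ge>0. \<forall>t\<ge>0. \<forall>x\<in>E. \<forall>y\<in>E. p (s + t) x y = (\<Sum>z\<in>E. p s x z * p t z y))"

(* Only the off-diagonal values of q are relevant. On a finite E the rows of p sum to 1,
   so these limits also give the derivative of p t x x at 0, namely minus the total jump
   rate out of x; hence they determine p. *)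
definition has_transition_rates ::
  "'s set \<Rightarrow> (real \<Rightarrow> 's \<Rightarrow> 's \<Rightarrow> real) \<Rightarrow> ('s \<Rightarrow> 's \<Rightarrow> real) \<Rightarrow> bool" where
  "has_transition_rates E p q \<longleftrightarrow>
     (\<forall>x\<in>E. \<forall>y\<in>E. x \<noteq> y \<longrightarrow> ((\<lambda>h. p h x y / h) \<longlongrightarrow> q x y) (at_right 0))"

definition markov_jump_process ::
  "'a measure \<Rightarrow> 's set \<Rightarrow> ('s \<Rightarrow> 's \<Rightarrow> real) \<Rightarrow> (real \<Rightarrow> 'a \<Rightarrow> 's::topological_space) \<Rightarrow> bool" where
  "markov_jump_process M E q X \<longleftrightarrow>
     (\<forall>t\<ge>0. X t \<in> M \<rightarrow>\<^sub>M count_space UNIV) \<and>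
     (\<forall>t\<ge>0. \<forall>\<omega>\<in>space M. X t \<omega> \<in> E) \<and>
     (\<forall>\<omega>\<in>space M. \<forall>t\<ge>0. continuous (at_right t) (\<lambda>s. X s \<omega>)) \<and>
     (\<exists>p. transition_function E p \<and> has_transition_rates E p q \<and>
        (\<forall>s\<ge>0. \<forall>h\<ge>0. \<forall>y\<in>E. AE \<omega> in M.
           real_cond_exp M (natural_filtration M X s) (\<lambda>\<omega>'. indicator {y} (X (s + h) \<omega>')) \<omega>
             = p h (X s \<omega>) y))"


section \<open>The Engset process\<close>

definition engset_rate :: "nat \<Rightarrow> nat \<Rightarrow> real \<Rightarrow> real \<Rightarrow> nat \<Rightarrow> nat \<Rightarrow> real" where
  "engset_rate N C \<nu> \<mu> x y =
     (if x = Suc y then \<mu> * real x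
      else if y = Suc x \<and> x < C then \<nu> * (real N - real x)
      else 0)"

(* The initial distribution on {0..C} is arbitrary. *)
definition engset_process ::
  "'a measure \<Rightarrow> nat \<Rightarrow> nat \<Rightarrow> real \<Rightarrow> real \<Rightarrow> (real \<Rightarrow> 'a \<Rightarrow> nat) \<Rightarrow> bool" where
  "engset_process M N C \<nu> \<mu> X \<longleftrightarrow> markov_jump_process M {0..C} (engset_rate N C \<nu> \<mu>) X"

definition engset_b :: "nat \<Rightarrow> nat \<Rightarrow> real \<Rightarrow> real \<Rightarrow> real \<Rightarrow> real" where
  "engset_b N C \<nu> \<mu> \<alpha> =
     \<nu> * (LBINT u:{0..1}. (1 - u) ^ C * (1 + \<nu> / \<mu> * u) powi (int N - int C - 1) * u powr \<alpha>)"

definition engset_d :: "nat \<Rightarrow> nat \<Rightarrow> real \<Rightarrow> real \<Rightarrow> real \<Rightarrow> real" where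
  "engset_d N C \<nu> \<mu> \<alpha> =
     \<mu> * (LBINT u:{0..1}. (1 - u) powi (int N - int C - 1) * (1 + \<mu> / \<nu> * u) ^ C * u powr \<alpha>)"

(* In I and J the truncated subtraction N - x is harmless, since x <= C <= N for all
   states x of the process. *)

definition engset_I ::
  "nat \<Rightarrow> real \<Rightarrow> real \<Rightarrow> real \<Rightarrow> (real \<Rightarrow> 'a \<Rightarrow> nat) \<Rightarrow> real \<Rightarrow> 'a \<Rightarrow> real" where
  "engset_I N \<nu> \<mu> \<alpha> X t \<omega> =
     exp (- \<alpha> * t) *
     (LBINT u:{0..1}. (1 - u) ^ X t \<omega> * (1 + \<nu> / \<mu> * u) ^ (N - X t \<omega>) * u powr (\<alpha> - 1))"

definition engset_J ::
  "nat \<Rightarrow> real \<Rightarrow> real \<Rightarrow> real \<Rightarrow> (real \<Rightarrow> 'a \<Rightarrow> nat) \<Rightarrow> real \<Rightarrow> 'a \<Rightarrow> real" where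
  "engset_J N \<nu> \<mu> \<alpha> X t \<omega> =
     exp (- \<alpha> * t) *
     (LBINT u:{0..1}. (1 - u) ^ (N - X t \<omega>) * (1 + \<mu> / \<nu> * u) ^ X t \<omega> * u powr (\<alpha> - 1))"

definition engset_K ::
  "nat \<Rightarrow> nat \<Rightarrow> real \<Rightarrow> real \<Rightarrow> real \<Rightarrow> (real \<Rightarrow> 'a \<Rightarrow> nat) \<Rightarrow> real \<Rightarrow> 'a \<Rightarrow> real" where
  "engset_K N C \<nu> \<mu> \<alpha> X t \<omega> =
     engset_d N C \<nu> \<mu> \<alpha> * engset_I N \<nu> \<mu> \<alpha> X t \<omega> +
     engset_b N C \<nu> \<mu> \<alpha> * engset_J N \<nu> \<mu> \<alpha> X t \<omega>"

(* The value is infinity if the state x is never visited. *)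
definition hitting_time :: "(real \<Rightarrow> 'a \<Rightarrow> 's) \<Rightarrow> 's \<Rightarrow> 'a \<Rightarrow> ereal" where
  "hitting_time X x \<omega> = Inf {ereal s | s. 0 \<le> s \<and> X s \<omega> = x}"

definition stopped_process ::
  "(real \<Rightarrow> 'a \<Rightarrow> 'b) \<Rightarrow> ('a \<Rightarrow> ereal) \<Rightarrow> real \<Rightarrow> 'a \<Rightarrow> 'b" where
  "stopped_process Z T t \<omega> = Z (real_of_ereal (min (ereal t) (T \<omega>))) \<omega>"

text \<open>
  For \<open>C = N\<close> the first factor of the integrand of \<open>engset_d\<close> is \<open>1 / (1 - u)\<close> and the
  integral diverges, as shown next. The Lebesgue integral on the reals would then be 0
  by convention instead of infinite, so statements about \<open>engset_d\<close> and \<open>engset_K\<close> have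
  their intended meaning exactly when \<open>C < N\<close>.
\<close>

lemma engset_d_integrable_iff:
  fixes N C :: nat and \<nu> \<mu> \<alpha> :: real
  assumes "\<nu> > 0" "\<mu> > 0" "\<alpha> > 0" "C \<le> N"
  shows "set_integrable lborel {0..1}
           (\<lambda>u. (1 - u) powi (int N - int C - 1) * (1 + \<mu> / \<nu> * u) ^ C * u powr \<alpha>) \<longleftrightarrow> C < N"
    (is "set_integrable _ _ ?f \<longleftrightarrow> _")
proof
  assume CN: "C < N"
  then have e: "int N - int C - 1 = int (N - C - 1)" by simp
  show "set_integrable lborel {0..1} ?f"
    unfolding e power_int_of_nat
    by (rule borel_integrable_atLeastAtMost')
      (use assms in \<open>auto intro!: continuous_intros continuous_on_powr'\<close>)
next
  assume int: "set_integrable lborel {0..1} ?f"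
  show "C < N"
  proof (rule ccontr)
    assume "\<not> C < N"
    with assms have NC: "N = C" by simp
    define c where "c = (1/2::real) powr \<alpha>"
    have c: "c > 0" by (simp add: c_def)
    define S where "S = (LBINT u:{0..1}. ?f u)"
    have nn: "0 \<le> ?f u" if "u \<in> {0..1}" for u
      using that assms by (auto intro!: mult_nonneg_nonneg zero_le_power add_nonneg_nonneg simp: NC power_int_minus)
    have bound: "c * (ln (1/2) - ln (1 - a)) \<le> S" if a: "1/2 < a" "a < 1" for a
    proof -
      let ?g = "\<lambda>u::real. c / (1 - u)"
      have cont: "continuous_on {1/2..a} ?g"
        using a by (intro continuous_intros) auto
      have gi: "set_integrable lborel {1/2..a} ?g"
        by (rule borel_integrable_atLeastAtMost'[OF cont])
      have "(LBINT u:{1/2..a}. ?g u) = (\<lambda>u. - c * ln (1 - u)) a - (\<lambda>u. - c * ln (1 - u)) (1/2)"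
        unfolding set_lebesgue_integral_def
      proof (rule integral_FTC_Icc)
        show "1/2 \<le> a" using a by simp
        show "((\<lambda>u. - c * ln (1 - u)) has_vector_derivative c / (1 - u)) (at u within {1/2..a})"
          if "1/2 \<le> u" "u \<le> a" for u
          using that a unfolding has_real_derivative_iff_has_vector_derivative[symmetric]
          by (auto intro!: derivative_eq_intros simp: field_simps)
      qed (rule cont)
      then have "c * (ln (1/2) - ln (1 - a)) = (LBINT u:{1/2..a}. ?g u)"
        by (simp add: algebra_simps)
      also have "\<dots> \<le> S"
        unfolding S_def set_lebesgue_integral_def
      proof (rule integral_mono)
        show "integrable lborel (\<lambda>u. indicat_real {1/2..a} u *\<^sub>R ?g u)"
          using gi by (simp add: set_integrable_def)
        show "integrable lborel (\<lambda>u. indicat_real {0..1} u *\<^sub>R ?f u)"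
          using int by (simp add: set_integrable_def)
        fix u :: real
        show "indicat_real {1/2..a} u *\<^sub>R ?g u \<le> indicat_real {0..1} u *\<^sub>R ?f u"
        proof (cases "u \<in> {1/2..a}")
          case True
          then have u: "1/2 \<le> u" "u < 1" using a by auto
          have h1: "c \<le> u powr \<alpha>"
            unfolding c_def using u assms by (intro powr_mono2) auto
          have h2: "1 \<le> (1 + \<mu> / \<nu> * u) ^ C"
            using u assms by (intro one_le_power) simp
          have "c * 1 \<le> u powr \<alpha> * (1 + \<mu> / \<nu> * u) ^ C"
            using h1 h2 c by (intro mult_mono) auto
          then have "c / (1 - u) \<le> u powr \<alpha> * (1 + \<mu> / \<nu> * u) ^ C / (1 - u)"
            using u by (intro divide_right_mono) auto
          then show ?thesis
            using True u by (simp add: NC power_int_minus field_simps)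
        next
          case False
          then show ?thesis using nn[of u] by (auto simp: indicator_def)
        qed
      qed
      finally show ?thesis .
    qed
    have S0: "S \<ge> 0"
      unfolding S_def set_lebesgue_integral_def
      by (intro Bochner_Integration.integral_nonneg)
        (use nn in \<open>auto simp: indicator_def\<close>)
    define a where "a = 1 - exp (- (S + 1) / c) / 2"
    have "exp (- (S + 1) / c) < 1" using S0 c by (simp add: divide_neg_pos)
    then have a: "1/2 < a" "a < 1" by (auto simp: a_def)
    have "ln (1 - a) = - (S + 1) / c - ln 2"
      by (simp add: a_def ln_div)
    then have "c * (ln (1/2) - ln (1 - a)) = S + 1"
      using c by (simp add: ln_div field_simps)
    with bound[OF a] show False by simp
  qed
qed

end

theory Submission
  imports Defs
begin

text \<open>
  Both \<open>I\<close> and \<open>J\<close> have the form \<open>exp (- \<alpha> t) g (X t)\<close>. For each fixed \<open>u\<close>, applying the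
  generator of the process without capacity constraint to the integrand
  \<open>h x u = (1 - u)^x (1 + \<nu>/\<mu> u)^(N - x)\<close> of \<open>I\<close> gives \<open>- u\<close> times the derivative of \<open>h\<close> in \<open>u\<close>,
  so integration by parts against \<open>u powr (\<alpha> - 1)\<close> shows that \<open>g\<close> satisfies \<open>L g = \<alpha> g\<close> in every
  state \<open>x\<close> with \<open>0 < x < N\<close>; \<open>J\<close> is the same with \<open>\<mu>, \<nu>\<close> and \<open>x, N - x\<close> exchanged. The
  coefficients \<open>d\<close> and \<open>b\<close> are such that the combination takes equal values at \<open>C\<close> and \<open>C + 1\<close>,
  so suppressing the jump from \<open>C\<close> to \<open>C + 1\<close> does not affect the equation.

  That \<open>exp (- \<alpha> t) g (X t)\<close> stopped at the hitting time of \<open>z\<close> is a martingale whenever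
  \<open>L g = \<alpha> g\<close> off \<open>z\<close> follows without optional stopping: on a grid of mesh \<open>\<delta>\<close> in \<open>[s, t]\<close>, stop
  at the first grid point at which the state is \<open>z\<close>. By the Markov property each step changes the
  mean by \<open>o(\<delta>)\<close>, hence the total change tends to 0, while by right continuity the values stopped
  on the grid converge to the stopped process.
\<close>

section \<open>The weighted integrals\<close>

lemma powr_set_integrable_0_1:
  fixes \<alpha> :: real
  assumes "\<alpha> > 0"
  shows "set_integrable lborel {0..1} (\<lambda>u. u powr (\<alpha> - 1))"
proof -
  have "(\<lambda>u::real. u powr (\<alpha> - 1)) absolutely_integrable_on {0..1}"
    using assms by (intro nonnegative_absolutely_integrable_1 integrable_on_powr_from_0) auto
  then show ?thesis
    unfolding set_integrable_def by (subst (asm) integrable_completion) auto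
qed

text \<open>The common shape of all four integrals: \<open>engset_I\<close> has
  \<open>c = \<nu> / \<mu>\<close> and exponents X, N - X, while \<open>engset_J\<close> has the
  reciprocal \<open>c\<close> and the exponents exchanged. For C < N, \<open>engset_b\<close> and
  \<open>engset_d\<close> are values at \<alpha> + 1 with exponents summing to N - 1.\<close>

definition weighted_integral :: "real \<Rightarrow> real \<Rightarrow> nat \<Rightarrow> nat \<Rightarrow> real" where
  "weighted_integral c \<alpha> a b =
     (LBINT u:{0..1}. (1 - u) ^ a * (1 + c * u) ^ b * u powr (\<alpha> - 1))"

text \<open>The polynomial factor is bounded on the compact interval, so a multiple of
  \<open>u powr (\<alpha> - 1)\<close> dominates the integrand.\<close>

lemma weighted_integrable:
  fixes c \<alpha> :: real
  assumes "\<alpha> > 0"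
  shows "set_integrable lborel {0..1} (\<lambda>u. (1 - u) ^ a * (1 + c * u) ^ b * u powr (\<alpha> - 1))"
proof -
  have "compact ((\<lambda>u. (1 - u) ^ a * (1 + c * u) ^ b) ` {0..1})"
    by (intro compact_continuous_image continuous_intros) auto
  then obtain B where B: "\<And>u. u \<in> {0..1} \<Longrightarrow> \<bar>(1 - u) ^ a * (1 + c * u) ^ b\<bar> \<le> B"
    by (fastforce dest: compact_imp_bounded simp: bounded_iff)
  show ?thesis
  proof (rule set_integrable_bound[OF set_integrable_mult_right[OF powr_set_integrable_0_1[OF assms], of B]])
    show "AE u in lborel. u \<in> {0..1} \<longrightarrow>
       norm ((1 - u) ^ a * (1 + c * u) ^ b * u powr (\<alpha> - 1)) \<le> norm (B * u powr (\<alpha> - 1))"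
      using B by (intro AE_I2) (force simp: abs_mult intro!: mult_right_mono)
  qed (auto simp: set_borel_measurable_def)
qed

text \<open>Pointwise, (1 + c u) - (1 - u) = (1 + c) u, and the extra factor u raises the parameter
  \<alpha> by one.\<close>

lemma weighted_integral_diff:
  assumes "\<alpha> > 0"
  shows "weighted_integral c \<alpha> a (Suc b) - weighted_integral c \<alpha> (Suc a) b =
           (1 + c) * weighted_integral c (\<alpha> + 1) a b"
proof -
  have "weighted_integral c \<alpha> a (Suc b) - weighted_integral c \<alpha> (Suc a) b =
    (LBINT u:{0..1}. (1 - u) ^ a * (1 + c * u) ^ Suc b * u powr (\<alpha> - 1) -
       (1 - u) ^ Suc a * (1 + c * u) ^ b * u powr (\<alpha> - 1))"
    unfolding weighted_integral_def
    by (rule set_integral_diff(2)[symmetric]; rule weighted_integrable[OF assms])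
  also have "\<dots> = (LBINT u:{0..1}. (1 + c) * ((1 - u) ^ a * (1 + c * u) ^ b * u powr (\<alpha> + 1 - 1)))"
  proof (intro set_lebesgue_integral_cong ballI allI impI)
    fix u :: real assume "u \<in> {0..1}"
    \<comment> \<open>At u = 0 both sides vanish, by the convention that \<open>0 powr _\<close> is
      0.\<close>
    then have "u powr (\<alpha> + 1 - 1) = u * u powr (\<alpha> - 1)"
      using assms by (cases "u = 0") (auto simp: powr_diff)
    then show "(1 - u) ^ a * (1 + c * u) ^ Suc b * u powr (\<alpha> - 1) -
       (1 - u) ^ Suc a * (1 + c * u) ^ b * u powr (\<alpha> - 1) =
      (1 + c) * ((1 - u) ^ a * (1 + c * u) ^ b * u powr (\<alpha> + 1 - 1))"
      by (simp add: algebra_simps)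
  qed simp
  finally show ?thesis
    by (simp add: weighted_integral_def)
qed

text \<open>Integration by parts; the boundary terms vanish because both \<open>\<alpha>\<close> and the exponent
  of \<open>1 - u\<close> are positive.\<close>

lemma weighted_integral_parts:
  assumes "\<alpha> > 0"
  shows "\<alpha> * weighted_integral c \<alpha> (Suc a) (Suc b) =
           real (Suc a) * weighted_integral c (\<alpha> + 1) a (Suc b) -
           c * real (Suc b) * weighted_integral c (\<alpha> + 1) (Suc a) b"
proof -
  let ?w = "\<lambda>\<beta> a b u. (1 - u) ^ a * (1 + c * u) ^ b * u powr (\<beta> - 1) :: real"
  let ?f = "\<lambda>u. \<alpha> * ?w \<alpha> (Suc a) (Suc b) u -
    (real (Suc a) * ?w (\<alpha> + 1) a (Suc b) u - c * real (Suc b) * ?w (\<alpha> + 1) (Suc a) b u)"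
  let ?F = "\<lambda>u::real. (1 - u) ^ Suc a * (1 + c * u) ^ Suc b * u powr \<alpha>"
  have w: "set_integrable lborel {0..1} (?w \<alpha> a' b')"
    "set_integrable lborel {0..1} (?w (\<alpha> + 1) a' b')" for a' b'
    by (rule weighted_integrable, use assms in simp)+
  have int: "set_integrable lborel {0..1} ?f"
    by (intro set_integral_diff(1) set_integrable_mult_right w)
  \<comment> \<open>\<open>?F\<close> need not be differentiable at 0 when \<alpha> < 1.
    Differentiability in the open interval and continuity up to the end points suffice.\<close>
  have "(?f has_integral (?F 1 - ?F 0)) {0..1}"
  proof (rule fundamental_theorem_of_calculus_interior)
    show "continuous_on {0..1} ?F"
      using assms by (intro continuous_intros continuous_on_powr') auto
    fix u :: real assume u: "u \<in> {0<..<1}"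
    show "(?F has_vector_derivative ?f u) (at u)"
      unfolding has_real_derivative_iff_has_vector_derivative[symmetric]
      using u by (auto intro!: derivative_eq_intros simp: algebra_simps simp del: power_Suc)
  qed simp
  then have "(LBINT u:{0..1}. ?f u) = 0"
    using set_borel_integral_eq_integral(2)[OF int] assms by (simp add: integral_unique)
  moreover have "(LBINT u:{0..1}. ?f u) = \<alpha> * weighted_integral c \<alpha> (Suc a) (Suc b) -
           (real (Suc a) * weighted_integral c (\<alpha> + 1) a (Suc b) -
           c * real (Suc b) * weighted_integral c (\<alpha> + 1) (Suc a) b)"
    unfolding weighted_integral_def
    by (subst set_integral_diff(2) set_integral_mult_right;
        (intro set_integral_diff(1) set_integrable_mult_right w)?)+ simp
  ultimately show ?thesis by simp
qed

text \<open>As 0 < x < N, both exponents are successors. The two differences of \<open>i\<close> are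
  integrals with parameter \<alpha> + 1, multiplied by 1 + \<nu>/\<mu> = 1/\<mu> (here \<mu> + \<nu>
  = 1 enters), and these are exactly the integrals on the right of
  \<open>weighted_integral_parts\<close>.\<close>

lemma weighted_integral_generator:
  fixes \<mu> \<nu> :: real
  assumes "\<mu> > 0" "\<mu> + \<nu> = 1" "\<alpha> > 0" "0 < x" "x < N"
  defines "i \<equiv> \<lambda>x. weighted_integral (\<nu> / \<mu>) \<alpha> x (N - x)"
  shows "\<mu> * real x * (i (x - 1) - i x) + \<nu> * (real N - real x) * (i (x + 1) - i x) = \<alpha> * i x"
proof -
  obtain a where a: "x = Suc a" using assms by (cases x) auto
  obtain b where b: "N - x = Suc b" using assms by (cases "N - x") auto
  have N: "N - (x - 1) = Suc (Suc b)" "N - (x + 1) = b" "real N - real x = real (Suc b)"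
    using a b by auto
  have c: "1 + \<nu> / \<mu> = 1 / \<mu>" using assms by (simp add: field_simps)
  let ?w = "weighted_integral (\<nu> / \<mu>) (\<alpha> + 1)"
  have i: "i (x - 1) = weighted_integral (\<nu> / \<mu>) \<alpha> a (Suc (Suc b))"
    "i x = weighted_integral (\<nu> / \<mu>) \<alpha> (Suc a) (Suc b)"
    "i (x + 1) = weighted_integral (\<nu> / \<mu>) \<alpha> (Suc (Suc a)) b"
    unfolding i_def N b by (simp_all add: a)
  have down: "i (x - 1) - i x = ?w a (Suc b) / \<mu>"
    unfolding i using weighted_integral_diff[OF \<open>\<alpha> > 0\<close>, of "\<nu> / \<mu>" a "Suc b"] by (simp add: c)
  have up: "i (x + 1) - i x = - ?w (Suc a) b / \<mu>"
    unfolding i using weighted_integral_diff[OF \<open>\<alpha> > 0\<close>, of "\<nu> / \<mu>" "Suc a" b] by (simp add: c)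
  have "\<alpha> * i x = real x * ?w a (Suc b) - \<nu> / \<mu> * (real N - real x) * ?w (Suc a) b"
    unfolding N i using weighted_integral_parts[OF \<open>\<alpha> > 0\<close>, of "\<nu> / \<mu>" a b] by (simp add: a)
  then show ?thesis
    unfolding up down using assms(1) by (simp add: field_simps)
qed

text \<open>The reflected state N - x moves up at rate \<mu> x and down at rate \<nu> (N - x), so
  the previous lemma applies to it with \<mu> and \<nu> exchanged.\<close>

lemma weighted_integral_generator_dual:
  fixes \<mu> \<nu> :: real
  assumes "\<nu> > 0" "\<mu> + \<nu> = 1" "\<alpha> > 0" "0 < x" "x < N"
  defines "j \<equiv> \<lambda>x. weighted_integral (\<mu> / \<nu>) \<alpha> (N - x) x"
  shows "\<mu> * real x * (j (x - 1) - j x) + \<nu> * (real N - real x) * (j (x + 1) - j x) = \<alpha> * j x"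
proof -
  have eq: "N - (N - x - 1) = x + 1" "N - (N - x) = x" "N - (N - x + 1) = x - 1"
    "N - x - 1 = N - (x + 1)" "N - x + 1 = N - (x - 1)"
    "real (N - x) = real N - real x" "real N - real (N - x) = real x"
    using assms by auto
  show ?thesis
    using weighted_integral_generator[of \<nu> \<mu> \<alpha> "N - x" N] assms(1-5)
    unfolding j_def eq by (simp add: eq add.commute)
qed

section \<open>Hitting times of right-continuous paths\<close>

lemma space_natural_filtration [simp]: "space (natural_filtration M X t) = space M"
  unfolding natural_filtration_def by (rule space_measure_of) auto

lemma sets_natural_filtration:
  "sets (natural_filtration M X t) =
     sigma_sets (space M) {X s -` A \<inter> space M | s A. 0 \<le> s \<and> s \<le> t}"
  unfolding natural_filtration_def by (rule sets_measure_of) auto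

lemma filtration_natural_filtration: "filtration (space M) (natural_filtration M X)"
proof
  show "sets (natural_filtration M X i) \<subseteq> sets (natural_filtration M X j)" if "i \<le> j" for i j
    unfolding sets_natural_filtration
    by (rule sigma_sets_mono', use that in \<open>fastforce intro: order_trans\<close>)
qed simp

lemma measurable_natural_filtration:
  assumes "0 \<le> s" "s \<le> t"
  shows "X s \<in> natural_filtration M X t \<rightarrow>\<^sub>M count_space UNIV"
proof (rule measurableI)
  fix A
  show "X s -` A \<inter> space (natural_filtration M X t) \<in> sets (natural_filtration M X t)"
    unfolding sets_natural_filtration space_natural_filtration
    by (rule sigma_sets.Basic) (use assms in auto)
qed simp

lemma subalgebra_natural_filtration:
  assumes "\<And>s. 0 \<le> s \<Longrightarrow> X s \<in> M \<rightarrow>\<^sub>M count_space UNIV"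
  shows "subalgebra M (natural_filtration M X t)"
  unfolding subalgebra_def sets_natural_filtration
  using assms by (auto intro!: sets.sigma_sets_subset measurable_sets[of _ M "count_space UNIV"])

text \<open>The event that the hitting time is at most \<open>t\<close>, stated without an infimum
  in the extended reals. For right-continuous paths \<open>hitting_time_le_iff\<close> proves the
  equivalence.\<close>

definition hits :: "(real \<Rightarrow> 'a \<Rightarrow> 's) \<Rightarrow> 's \<Rightarrow> real \<Rightarrow> 'a \<Rightarrow> bool" where
  "hits X z t \<omega> \<longleftrightarrow> (\<exists>r. 0 \<le> r \<and> r \<le> t \<and> X r \<omega> = z)"

lemma hitsI: "\<lbrakk>0 \<le> r; r \<le> t; X r \<omega> = z\<rbrakk> \<Longrightarrow> hits X z t \<omega>"
  unfolding hits_def by blast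

lemma hits_mono: "hits X z s \<omega> \<Longrightarrow> s \<le> t \<Longrightarrow> hits X z t \<omega>"
  unfolding hits_def by force

definition right_cont_path :: "(real \<Rightarrow> 'a \<Rightarrow> 's :: topological_space) \<Rightarrow> 'a \<Rightarrow> bool" where
  "right_cont_path X \<omega> \<longleftrightarrow> (\<forall>t\<ge>0. continuous (at_right t) (\<lambda>s. X s \<omega>))"

text \<open>In a discrete topology convergence means being eventually constant, so the path keeps
  its state for a positive time.\<close>

lemma right_cont_pathE:
  fixes X :: "real \<Rightarrow> 'a \<Rightarrow> 's :: discrete_topology"
  assumes "right_cont_path X \<omega>" "t \<ge> 0"
  obtains \<epsilon> where "\<epsilon> > 0" "\<And>r. t \<le> r \<Longrightarrow> r < t + \<epsilon> \<Longrightarrow> X r \<omega> = X t \<omega>"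
proof -
  have "eventually (\<lambda>r. X r \<omega> = X t \<omega>) (at_right t)"
    using assms by (simp add: right_cont_path_def continuous_within tendsto_discrete)
  then obtain b where b: "b > t" "\<And>r. t < r \<Longrightarrow> r < b \<Longrightarrow> X r \<omega> = X t \<omega>"
    by (auto simp: eventually_at_right_field)
  show ?thesis
    by (rule that[of "b - t"]) (use b in \<open>auto simp: le_less\<close>)
qed

context
  fixes X :: "real \<Rightarrow> 'a \<Rightarrow> 's :: discrete_topology" and z :: 's and \<omega> :: 'a
  assumes path: "right_cont_path X \<omega>"
begin

text \<open>A visit to \<open>z\<close> before \<open>t\<close> lasts for some time and hence
  contains a rational time; only a visit at \<open>t\<close> itself has to be listed separately.
  This exhibits the event as a countable union.\<close>

lemma hits_iff_rational:
  assumes "t \<ge> 0"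
  shows "hits X z t \<omega> \<longleftrightarrow> (\<exists>r\<in>insert t (\<rat> \<inter> {0..t}). X r \<omega> = z)"
proof
  assume "hits X z t \<omega>"
  then obtain r where r: "0 \<le> r" "r \<le> t" "X r \<omega> = z" by (auto simp: hits_def)
  show "\<exists>r\<in>insert t (\<rat> \<inter> {0..t}). X r \<omega> = z"
  proof (cases "r = t")
    case False
    obtain \<epsilon> where e: "\<epsilon> > 0" "\<And>u. r \<le> u \<Longrightarrow> u < r + \<epsilon> \<Longrightarrow> X u \<omega> = X r \<omega>"
      using right_cont_pathE[OF path r(1)] by blast
    obtain u where "u \<in> \<rat>" "r < u" "u < min t (r + \<epsilon>)"
      using Rats_dense_in_real[of r "min t (r + \<epsilon>)"] e(1) r False by auto
    then show ?thesis using e(2)[of u] r by auto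
  qed (use r in auto)
qed (use assms in \<open>auto simp: hits_def\<close>)

text \<open>If \<open>z\<close> is not visited up to \<open>t\<close>, right continuity at
  \<open>t\<close> keeps the path away from \<open>z\<close> up to some t + \<epsilon>, so the
  infimum is at least t + \<epsilon>. For negative \<open>t\<close> both sides are false.\<close>

lemma hitting_time_le_iff: "hitting_time X z \<omega> \<le> ereal t \<longleftrightarrow> hits X z t \<omega>"
proof
  show "hitting_time X z \<omega> \<le> ereal t" if "hits X z t \<omega>"
    using that unfolding hits_def hitting_time_def by (force intro: Inf_lower2)
  show "hits X z t \<omega>" if le: "hitting_time X z \<omega> \<le> ereal t"
  proof (rule ccontr)
    assume no: "\<not> hits X z t \<omega>"
    have "0 \<le> hitting_time X z \<omega>"
      unfolding hitting_time_def by (rule Inf_greatest) auto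
    with le have t: "t \<ge> 0" by (metis ereal_less_eq(5) order_trans)
    then obtain \<epsilon> where e: "\<epsilon> > 0" "\<And>u. t \<le> u \<Longrightarrow> u < t + \<epsilon> \<Longrightarrow> X u \<omega> = X t \<omega>"
      using right_cont_pathE[OF path] by blast
    have "ereal (t + \<epsilon>) \<le> hitting_time X z \<omega>"
      unfolding hitting_time_def
    proof (rule Inf_greatest)
      fix y assume "y \<in> {ereal s |s. 0 \<le> s \<and> X s \<omega> = z}"
      then obtain s where s: "y = ereal s" "0 \<le> s" "X s \<omega> = z" by auto
      have "t < s" using no hitsI[of s t X \<omega> z] s(2,3) by (cases "s \<le> t") auto
      have "X t \<omega> \<noteq> z" using no t unfolding hits_def by auto
      then have "t + \<epsilon> \<le> s" using e(2)[of s] s \<open>t < s\<close> by force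
      then show "ereal (t + \<epsilon>) \<le> y" using s by simp
    qed
    then have "ereal (t + \<epsilon>) \<le> ereal t" using le by (rule order_trans)
    with e(1) show False by simp
  qed
qed

text \<open>The infimum is attained: \<open>hitting_time_le_iff\<close> at T gives a visit no later
  than T, and at earlier times it excludes one.\<close>

lemma hitting_timeE:
  assumes "hits X z t \<omega>"
  obtains T where "hitting_time X z \<omega> = ereal T" "0 \<le> T" "T \<le> t" "X T \<omega> = z"
    "\<And>r. 0 \<le> r \<Longrightarrow> r < T \<Longrightarrow> X r \<omega> \<noteq> z"
proof -
  have ge: "0 \<le> hitting_time X z \<omega>"
    unfolding hitting_time_def by (rule Inf_greatest) auto
  moreover have le: "hitting_time X z \<omega> \<le> ereal t"
    using assms by (simp add: hitting_time_le_iff)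
  ultimately obtain T where T: "hitting_time X z \<omega> = ereal T"
    by (cases "hitting_time X z \<omega>") auto
  have not: "X r \<omega> \<noteq> z" if "0 \<le> r" "r < T" for r
    using that T hitting_time_le_iff[of r] by (auto simp: hits_def)
  have "hits X z T \<omega>" using T hitting_time_le_iff[of T] by simp
  then have "X T \<omega> = z" using not by (auto simp: hits_def le_less)
  then show ?thesis using that[OF T] T ge le not by auto
qed

lemma stopped_process_not_hits:
  assumes "\<not> hits X z t \<omega>"
  shows "stopped_process Z (hitting_time X z) t \<omega> = Z t \<omega>"
proof -
  have "min (ereal t) (hitting_time X z \<omega>) = ereal t"
    using assms hitting_time_le_iff[of t] by (auto simp: min_def)
  then show ?thesis by (simp add: stopped_process_def)
qed

lemma stopped_process_hits_const:
  assumes "hits X z s \<omega>" "s \<le> t"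
  shows "stopped_process Z (hitting_time X z) t \<omega> = stopped_process Z (hitting_time X z) s \<omega>"
proof -
  obtain T where "hitting_time X z \<omega> = ereal T" "T \<le> s"
    by (rule hitting_timeE[OF assms(1)])
  then show ?thesis using assms(2) by (simp add: stopped_process_def min_absorb2)
qed

text \<open>Truncation at \<open>t\<close> cannot bring the value down to a level a < t. Hence these
  level sets of the truncated time are events known at time \<open>a\<close>.\<close>

lemma truncated_hitting_time_le_iff:
  assumes "0 \<le> t" "a < t"
  shows "real_of_ereal (min (ereal t) (hitting_time X z \<omega>)) \<le> a \<longleftrightarrow> hits X z a \<omega>"
proof (cases "hits X z t \<omega>")
  case True
  then obtain T where T: "hitting_time X z \<omega> = ereal T" "T \<le> t" by (rule hitting_timeE)
  then have "min (ereal t) (hitting_time X z \<omega>) = ereal T" by (simp add: min_def)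
  then show ?thesis using hitting_time_le_iff[of a] T by simp
next
  case False
  then have "min (ereal t) (hitting_time X z \<omega>) = ereal t"
    using hitting_time_le_iff[of t] by (auto simp: min_def)
  then show ?thesis using False hits_mono[of X z a \<omega> t] assms by auto
qed

end

text \<open>The value of \<open>v\<close> at the minimum of \<open>k\<close> and the first index at
  which \<open>D\<close> holds. The test runs over j \<le> k only: whether the step from
  \<open>k\<close> to \<open>Suc k\<close> is taken is decided at index \<open>k\<close>, and the
  value at the first stopping index is still recorded.\<close>

primrec stopped_seq :: "(nat \<Rightarrow> bool) \<Rightarrow> (nat \<Rightarrow> real) \<Rightarrow> nat \<Rightarrow> real" where
  "stopped_seq D v 0 = v 0"
| "stopped_seq D v (Suc k) = (if \<exists>j\<le>k. D j then stopped_seq D v k else v (Suc k))"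

lemma stopped_seq_before: "(\<And>j. j < k \<Longrightarrow> \<not> D j) \<Longrightarrow> stopped_seq D v k = v k"
  by (cases k) auto

lemma stopped_seq_after:
  "\<lbrakk>D m; \<And>j. j < m \<Longrightarrow> \<not> D j; m \<le> k\<rbrakk> \<Longrightarrow> stopped_seq D v k = v m"
proof (induction k)
  case (Suc k)
  then show ?case
    by (cases "m = Suc k") (auto simp: stopped_seq_before)
qed simp

lemma stopped_seq_abs_le: "(\<And>j. \<bar>v j\<bar> \<le> B) \<Longrightarrow> \<bar>stopped_seq D v k\<bar> \<le> B"
  by (induction k) auto

text \<open>An increment of \<open>v\<close> times an indicator that depends on \<open>D\<close> up
  to \<open>k\<close> only. This is the form to which the Markov property at the k-th grid time
  applies.\<close>

lemma stopped_seq_step: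
  "stopped_seq D v (Suc k) - stopped_seq D v k = (if \<exists>j\<le>k. D j then 0 else v (Suc k) - v k)"
  by (auto simp: stopped_seq_before)

text \<open>Let T be the hitting time and suppose T \<le> t. The first grid point not before T
  exceeds T by less than the mesh. Once the mesh is below the time that the path stays in
  \<open>z\<close>, the grid detects the visit there, and only the exponential factor is evaluated
  slightly late. Without a visit up to \<open>t\<close>, the grid value is that at \<open>t\<close>,
  the last grid point.\<close>

lemma stopped_seq_tendsto:
  fixes X :: "real \<Rightarrow> 'a \<Rightarrow> 's :: discrete_topology" and g :: "'s \<Rightarrow> real" and \<alpha> s t :: real
  defines "r \<equiv> \<lambda>n j. s + real j * ((t - s) / real (Suc n))"
    and "Z \<equiv> \<lambda>u \<omega>. exp (- \<alpha> * u) * g (X u \<omega>)"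
  assumes path: "right_cont_path X \<omega>"
    and "0 \<le> s" "s < t" "\<alpha> \<ge> 0" and nh: "\<not> hits X z s \<omega>"
  shows "(\<lambda>n. stopped_seq (\<lambda>j. X (r n j) \<omega> = z) (\<lambda>j. Z (r n j) \<omega>) (Suc n))
           \<longlonglongrightarrow> stopped_process Z (hitting_time X z) t \<omega>"
proof -
  let ?\<delta> = "\<lambda>n. (t - s) / real (Suc n)"
  have \<delta>: "?\<delta> n > 0" for n using \<open>s < t\<close> by simp
  have r0: "r n j \<ge> 0" for n j
    using \<delta>[of n] \<open>0 \<le> s\<close> unfolding r_def by (intro add_nonneg_nonneg mult_nonneg_nonneg) auto
  have rt: "r n (Suc n) = t" for n by (simp add: r_def)
  have r_mono: "r n i < r n j" if "i < j" for n i j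
    using that \<delta>[of n] unfolding r_def by (intro add_strict_left_mono mult_strict_right_mono) auto
  show ?thesis
  proof (cases "hits X z t \<omega>")
    case False
    have "X (r n j) \<omega> \<noteq> z" if "j < Suc n" for n j
      using False r0[of n j] r_mono[OF that, of n] by (auto simp: hits_def rt)
    then have "stopped_seq (\<lambda>j. X (r n j) \<omega> = z) (\<lambda>j. Z (r n j) \<omega>) (Suc n) = Z t \<omega>" for n
      by (subst stopped_seq_before) (auto simp: rt)
    then show ?thesis
      using stopped_process_not_hits[where Z = Z, OF path False] by simp
  next
    case True
    obtain T where T: "hitting_time X z \<omega> = ereal T" "0 \<le> T" "T \<le> t" "X T \<omega> = z"
      "\<And>r. 0 \<le> r \<Longrightarrow> r < T \<Longrightarrow> X r \<omega> \<noteq> z"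
      using hitting_timeE[OF path True] by blast
    have "s < T" using nh hitsI[of T s X \<omega> z] T(2,4) by (cases "T \<le> s") auto
    obtain \<epsilon> where e: "\<epsilon> > 0" "\<And>u. T \<le> u \<Longrightarrow> u < T + \<epsilon> \<Longrightarrow> X u \<omega> = X T \<omega>"
      using right_cont_pathE[OF path T(2)] by blast
    have lim0: "?\<delta> \<longlonglongrightarrow> 0"
      using LIMSEQ_Suc[OF lim_const_over_n[of "t - s"]] by simp
    have ev: "eventually (\<lambda>n. ?\<delta> n < \<epsilon>) sequentially"
      using order_tendstoD(2)[OF lim0 e(1)] .
    have stop: "stopped_process Z (hitting_time X z) t \<omega> = exp (- \<alpha> * T) * g z"
      using T by (simp add: stopped_process_def min_def Z_def)
    have bound: "\<bar>stopped_seq (\<lambda>j. X (r n j) \<omega> = z) (\<lambda>j. Z (r n j) \<omega>) (Suc n) - exp (- \<alpha> * T) * g z\<bar>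
        \<le> (exp (- \<alpha> * T) - exp (- \<alpha> * (T + ?\<delta> n))) * \<bar>g z\<bar>" if n: "?\<delta> n < \<epsilon>" for n
    proof -
      \<comment> \<open>The index of the first grid point that is not before T; it is positive
        because s < T.\<close>
      define m where "m = nat \<lceil>(T - s) / ?\<delta> n\<rceil>"
      have pos: "(T - s) / ?\<delta> n > 0" using \<open>s < T\<close> by (intro divide_pos_pos \<delta>) simp
      have m: "(T - s) / ?\<delta> n \<le> real m" "real m < (T - s) / ?\<delta> n + 1"
        using pos unfolding m_def by linarith+
      have m1: "T \<le> r n m" using m(1) unfolding pos_divide_le_eq[OF \<delta>] r_def by linarith
      have "real m - 1 < (T - s) / ?\<delta> n" using m(2) by linarith
      then have m2: "r n m < T + ?\<delta> n"
        unfolding pos_less_divide_eq[OF \<delta>] r_def left_diff_distrib by linarith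
      have "(T - s) / ?\<delta> n \<le> (t - s) / ?\<delta> n"
        using T(3) \<delta>[of n] by (intro divide_right_mono) auto
      also have "\<dots> = real (Suc n)" using \<open>s < t\<close> by simp
      finally have "real m < real (Suc n) + 1" using m(2) by linarith
      then have "m \<le> Suc n" by linarith
      moreover have "X (r n m) \<omega> = z" using e(2)[OF m1] m2 n T(4) by simp
      \<comment> \<open>Grid points with smaller index lie strictly before T, the time of the first
        visit.\<close>
      moreover have "X (r n j) \<omega> \<noteq> z" if "j < m" for j
      proof (rule T(5)[OF r0])
        have "real j + 1 \<le> real m" using that by linarith
        then have "real j < (T - s) / ?\<delta> n" using m(2) by linarith
        then show "r n j < T" unfolding pos_less_divide_eq[OF \<delta>] r_def by linarith
      qed
      ultimately have eq: "stopped_seq (\<lambda>j. X (r n j) \<omega> = z) (\<lambda>j. Z (r n j) \<omega>) (Suc n)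
          = exp (- \<alpha> * r n m) * g z"
        by (subst stopped_seq_after[of _ m]) (auto simp: Z_def)
      have "\<alpha> * T \<le> \<alpha> * r n m" "\<alpha> * r n m \<le> \<alpha> * (T + ?\<delta> n)"
        using m1 m2 \<open>\<alpha> \<ge> 0\<close> by (auto intro!: mult_left_mono simp del: of_nat_Suc)
      then have "exp (- \<alpha> * (T + ?\<delta> n)) \<le> exp (- \<alpha> * r n m)" "exp (- \<alpha> * r n m) \<le> exp (- \<alpha> * T)"
        by (auto simp del: of_nat_Suc)
      then have "\<bar>exp (- \<alpha> * r n m) - exp (- \<alpha> * T)\<bar> \<le> exp (- \<alpha> * T) - exp (- \<alpha> * (T + ?\<delta> n))"
        by linarith
      then show ?thesis
        unfolding eq left_diff_distrib[symmetric] abs_mult by (rule mult_right_mono) simp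
    qed
    have "eventually (\<lambda>n. norm (stopped_seq (\<lambda>j. X (r n j) \<omega> = z) (\<lambda>j. Z (r n j) \<omega>) (Suc n) - exp (- \<alpha> * T) * g z)
        \<le> (exp (- \<alpha> * T) - exp (- \<alpha> * (T + ?\<delta> n))) * \<bar>g z\<bar>) sequentially"
      using ev unfolding real_norm_def by (rule eventually_mono) (rule bound)
    moreover have "(\<lambda>n. (exp (- \<alpha> * T) - exp (- \<alpha> * (T + ?\<delta> n))) * \<bar>g z\<bar>) \<longlonglongrightarrow>
        (exp (- \<alpha> * T) - exp (- \<alpha> * (T + 0))) * \<bar>g z\<bar>"
      by (intro tendsto_intros lim0)
    then have "(\<lambda>n. (exp (- \<alpha> * T) - exp (- \<alpha> * (T + ?\<delta> n))) * \<bar>g z\<bar>) \<longlonglongrightarrow> 0"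
      by (simp only: add_0_right diff_self mult_zero_left)
    ultimately have "(\<lambda>n. stopped_seq (\<lambda>j. X (r n j) \<omega> = z) (\<lambda>j. Z (r n j) \<omega>) (Suc n) - exp (- \<alpha> * T) * g z) \<longlonglongrightarrow> 0"
      by (rule Lim_null_comparison)
    then show ?thesis unfolding stop LIM_zero_iff .
  qed
qed

section \<open>Stopped eigenfunctions of finite Markov jump processes\<close>

text \<open>The transition function, existentially quantified in \<open>markov_jump_process\<close>,
  is fixed here as a parameter \<open>p\<close>. Nothing in the locale is specific to birth and
  death processes.\<close>

locale finite_markov_jump = prob_space M
  for M :: "'a measure" +
  fixes E :: "'s :: discrete_topology set" and q :: "'s \<Rightarrow> 's \<Rightarrow> real"
    and X :: "real \<Rightarrow> 'a \<Rightarrow> 's" and p :: "real \<Rightarrow> 's \<Rightarrow> 's \<Rightarrow> real"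
  assumes finite_E: "finite E"
    and X_measurable: "t \<ge> 0 \<Longrightarrow> X t \<in> M \<rightarrow>\<^sub>M count_space UNIV"
    and X_in_E: "t \<ge> 0 \<Longrightarrow> \<omega> \<in> space M \<Longrightarrow> X t \<omega> \<in> E"
    and path: "\<omega> \<in> space M \<Longrightarrow> right_cont_path X \<omega>"
    and trans: "transition_function E p"
    and rates: "has_transition_rates E p q"
    and markov: "\<lbrakk>s \<ge> 0; h \<ge> 0; y \<in> E\<rbrakk> \<Longrightarrow> AE \<omega> in M.
       real_cond_exp M (natural_filtration M X s) (\<lambda>\<omega>'. indicator {y} (X (s + h) \<omega>')) \<omega>
         = p h (X s \<omega>) y"
begin

abbreviation "F \<equiv> natural_filtration M X"

lemma subalgebra_F: "subalgebra M (F t)"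
  by (rule subalgebra_natural_filtration[OF X_measurable])

lemma sets_F: "A \<in> sets (F t) \<Longrightarrow> A \<in> sets M"
  using subalgebra_F by (auto simp: subalgebra_def)

lemma sets_F_mono: "s \<le> t \<Longrightarrow> A \<in> sets (F s) \<Longrightarrow> A \<in> sets (F t)"
  using filtration.sets_F_mono[OF filtration_natural_filtration] by blast

lemma sigma_finite_F: "sigma_finite_subalgebra M (F t)"
  by (intro finite_measure_subalgebra_is_sigma_finite finite_measure_subalgebra.intro
      finite_measure_axioms finite_measure_subalgebra_axioms.intro subalgebra_F)

lemma measurable_of_X [measurable]:
  fixes u :: "'s \<Rightarrow> real"
  shows "t \<ge> 0 \<Longrightarrow> (\<lambda>\<omega>. u (X t \<omega>)) \<in> borel_measurable M"
  by (rule measurable_compose[OF X_measurable]) auto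

lemma bounded_on_E:
  fixes u :: "'s \<Rightarrow> real"
  obtains B where "B \<ge> 0" "\<And>x. x \<in> E \<Longrightarrow> \<bar>u x\<bar> \<le> B"
  by (rule that[of "\<Sum>x\<in>E. \<bar>u x\<bar>"])
     (use finite_E in \<open>auto intro: member_le_sum sum_nonneg\<close>)

lemma integrable_bounded:
  fixes f :: "'a \<Rightarrow> real"
  assumes "f \<in> borel_measurable M" "\<And>\<omega>. \<omega> \<in> space M \<Longrightarrow> \<bar>f \<omega>\<bar> \<le> B"
  shows "integrable M f"
  by (rule integrable_const_bound[of _ B]) (use assms in auto)

lemma integrable_of_X [simp, intro]:
  fixes u :: "'s \<Rightarrow> real"
  assumes "t \<ge> 0"
  shows "integrable M (\<lambda>\<omega>. u (X t \<omega>))"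
proof -
  obtain B where "\<And>x. x \<in> E \<Longrightarrow> \<bar>u x\<bar> \<le> B" using bounded_on_E[of u] by blast
  then show ?thesis
    using assms X_in_E by (intro integrable_bounded[of _ B]) auto
qed

lemma integrable_indicator_mult:
  fixes f :: "'a \<Rightarrow> real"
  shows "A \<in> sets M \<Longrightarrow> integrable M f \<Longrightarrow> integrable M (\<lambda>\<omega>. indicator A \<omega> * f \<omega>)"
  using integrable_mult_indicator[of A M f] by simp

text \<open>On the finite set \<open>E\<close> a function \<open>g\<close> is a linear combination
  of indicators of single states, for which the Markov property is assumed. Integrating over an
  event of the past removes the conditional expectation.\<close>

lemma markov_integral:
  fixes g :: "'s \<Rightarrow> real"
  assumes s: "s \<ge> 0" "h \<ge> 0" and B: "B \<in> sets (F s)"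
  shows "(\<integral>\<omega>. indicator B \<omega> * g (X (s + h) \<omega>) \<partial>M) =
         (\<integral>\<omega>. indicator B \<omega> * (\<Sum>y\<in>E. p h (X s \<omega>) y * g y) \<partial>M)"
proof -
  interpret sigma_finite_subalgebra M "F s" by (rule sigma_finite_F)
  have BM: "B \<in> sets M" using B by (rule sets_F)
  have y: "(\<integral>\<omega>. indicator B \<omega> * indicator {y} (X (s + h) \<omega>) \<partial>M) =
      (\<integral>\<omega>. indicator B \<omega> * p h (X s \<omega>) y \<partial>M)" if "y \<in> E" for y
  proof -
    have int: "integrable M (\<lambda>\<omega>. indicator {y} (X (s + h) \<omega>) :: real)"
      using s by (intro integrable_of_X) simp
    have "(\<integral>\<omega>. indicator B \<omega> * indicator {y} (X (s + h) \<omega>) \<partial>M) =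
      (\<integral>\<omega>. indicator B \<omega> * real_cond_exp M (F s) (\<lambda>\<omega>. indicator {y} (X (s + h) \<omega>)) \<omega> \<partial>M)"
      using real_cond_exp_intA[OF int B] by (simp add: set_lebesgue_integral_def)
    also have "\<dots> = (\<integral>\<omega>. indicator B \<omega> * p h (X s \<omega>) y \<partial>M)"
    proof (rule integral_cong_AE)
      show "(\<lambda>\<omega>. indicator B \<omega> * p h (X s \<omega>) y) \<in> borel_measurable M"
        using BM s measurable_of_X[of s "\<lambda>x. p h x y"] by measurable
    qed (use BM markov[OF s that] in auto)
    finally show ?thesis .
  qed
  have "(\<integral>\<omega>. indicator B \<omega> * g (X (s + h) \<omega>) \<partial>M) =
      (\<integral>\<omega>. (\<Sum>y\<in>E. g y * (indicator B \<omega> * indicator {y} (X (s + h) \<omega>))) \<partial>M)"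
  proof (rule Bochner_Integration.integral_cong[OF refl])
    fix \<omega> assume "\<omega> \<in> space M"
    then have "X (s + h) \<omega> \<in> E" using s by (intro X_in_E) auto
    then show "indicator B \<omega> * g (X (s + h) \<omega>) =
        (\<Sum>y\<in>E. g y * (indicator B \<omega> * indicator {y} (X (s + h) \<omega>)))"
      using finite_E by (simp add: indicator_def mult_ac if_distrib[of "(*) _"] sum.If_cases cong: if_cong)
  qed
  also have "\<dots> = (\<Sum>y\<in>E. g y * (\<integral>\<omega>. indicator B \<omega> * indicator {y} (X (s + h) \<omega>) \<partial>M))"
    using s by (subst Bochner_Integration.integral_sum)
      (auto intro!: integrable_mult_right integrable_indicator_mult[OF BM] integrable_of_X)
  also have "\<dots> = (\<Sum>y\<in>E. g y * (\<integral>\<omega>. indicator B \<omega> * p h (X s \<omega>) y \<partial>M))"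
    using y by (intro sum.cong) auto
  also have "\<dots> = (\<integral>\<omega>. (\<Sum>y\<in>E. g y * (indicator B \<omega> * p h (X s \<omega>) y)) \<partial>M)"
    using s by (subst Bochner_Integration.integral_sum)
      (auto intro!: integrable_mult_right integrable_indicator_mult[OF BM] integrable_of_X[where u = "\<lambda>x. p h x _"])
  also have "\<dots> = (\<integral>\<omega>. indicator B \<omega> * (\<Sum>y\<in>E. p h (X s \<omega>) y * g y) \<partial>M)"
    by (simp add: sum_distrib_left mult_ac)
  finally show ?thesis .
qed

text \<open>The derivative at 0 of the semigroup discounted at rate \<alpha>. As the rows of
  \<open>p\<close> sum to 1, the increment of the undiscounted semigroup is a sum over y \<noteq> x
  of \<open>p h x y * (g y - g x)\<close>, so the off-diagonal rates determine its limit after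
  division by \<open>h\<close>.\<close>

lemma semigroup_increment_tendsto:
  fixes g :: "'s \<Rightarrow> real"
  assumes x: "x \<in> E"
  shows "((\<lambda>h. (exp (- \<alpha> * h) * (\<Sum>y\<in>E. p h x y * g y) - g x) / h) \<longlongrightarrow>
           (\<Sum>y\<in>E - {x}. q x y * (g y - g x)) - \<alpha> * g x) (at_right 0)"
proof -
  have "((\<lambda>h. exp (- \<alpha> * h)) has_real_derivative - \<alpha>) (at 0)"
    by (auto intro!: derivative_eq_intros)
  then have "((\<lambda>h. (exp (- \<alpha> * h) - 1) / h) \<longlongrightarrow> - \<alpha>) (at 0)"
    by (simp add: DERIV_def)
  then have exp_lim: "((\<lambda>h. (exp (- \<alpha> * h) - 1) / h) \<longlongrightarrow> - \<alpha>) (at_right 0)"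
    by (rule tendsto_mono[rotated]) (simp add: at_le)
  have p_lim: "((\<lambda>h. p h x y / h) \<longlongrightarrow> q x y) (at_right 0)" if "y \<in> E - {x}" for y
    using rates x that by (auto simp: has_transition_rates_def)
  have "((\<lambda>h. exp (- \<alpha> * h) * (\<Sum>y\<in>E - {x}. p h x y / h * (g y - g x)) +
      (exp (- \<alpha> * h) - 1) / h * g x) \<longlongrightarrow>
      exp (- \<alpha> * 0) * (\<Sum>y\<in>E - {x}. q x y * (g y - g x)) + - \<alpha> * g x) (at_right 0)"
    by (intro tendsto_intros exp_lim p_lim)
  moreover have "eventually (\<lambda>h. exp (- \<alpha> * h) * (\<Sum>y\<in>E - {x}. p h x y / h * (g y - g x)) +
      (exp (- \<alpha> * h) - 1) / h * g x =
      (exp (- \<alpha> * h) * (\<Sum>y\<in>E. p h x y * g y) - g x) / h) (at_right 0)"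
    using eventually_at_right_less[of "0::real"]
  proof eventually_elim
    case (elim h)
    have row: "(\<Sum>y\<in>E. p h x y) = 1"
      using trans x elim by (auto simp: transition_function_def)
    have "(\<Sum>y\<in>E - {x}. p h x y * (g y - g x)) = (\<Sum>y\<in>E. p h x y * (g y - g x))"
      using finite_E by (intro sum.mono_neutral_left) auto
    also have "\<dots> = (\<Sum>y\<in>E. p h x y * g y) - g x"
      using row by (simp add: right_diff_distrib sum_subtractf flip: sum_distrib_right)
    finally have *: "(\<Sum>y\<in>E - {x}. p h x y / h * (g y - g x)) =
        ((\<Sum>y\<in>E. p h x y * g y) - g x) / h"
      by (simp flip: sum_divide_distrib)
    show ?case unfolding * using elim by (simp add: field_simps)
  qed
  ultimately show ?thesis by (simp add: tendsto_cong)
qed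

lemma hits_sets:
  assumes "t \<ge> 0"
  shows "{\<omega>\<in>space M. hits X z t \<omega>} \<in> sets (F t)"
proof -
  have *: "X r -` {z} \<inter> space (F t) \<in> sets (F t)" if "r \<in> insert t (\<rat> \<inter> {0..t})" for r
    using that assms by (intro measurable_sets[OF measurable_natural_filtration]) auto
  have "{\<omega>\<in>space M. hits X z t \<omega>} =
      (\<Union>r\<in>insert t (\<rat> \<inter> {0..t}). X r -` {z} \<inter> space (F t))"
    using hits_iff_rational[OF path assms] by auto
  also have "\<dots> \<in> sets (F t)"
    using * by (intro sets.countable_UN'') (auto intro: countable_subset[OF _ countable_rat])
  finally show ?thesis .
qed

section \<open>Martingale property of eigenfunctions stopped on hitting \<open>z\<close>\<close>

context
  fixes g :: "'s \<Rightarrow> real" and \<alpha> :: real and z :: 's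
  assumes \<alpha>: "\<alpha> \<ge> 0"
    and eigen: "\<And>x. x \<in> E \<Longrightarrow> x \<noteq> z \<Longrightarrow> (\<Sum>y\<in>E - {x}. q x y * (g y - g x)) = \<alpha> * g x"
begin

abbreviation "Z \<equiv> \<lambda>t \<omega>. exp (- \<alpha> * t) * g (X t \<omega>)"
abbreviation "SZ \<equiv> stopped_process Z (hitting_time X z)"

lemma Z_bound: "\<exists>B. \<forall>t \<omega>. t \<ge> 0 \<longrightarrow> \<omega> \<in> space M \<longrightarrow> \<bar>Z t \<omega>\<bar> \<le> B"
proof -
  obtain B where B: "B \<ge> 0" "\<And>x. x \<in> E \<Longrightarrow> \<bar>g x\<bar> \<le> B" using bounded_on_E[of g] by blast
  show ?thesis
  proof (intro exI allI impI)
    fix t :: real and \<omega> assume *: "t \<ge> 0" "\<omega> \<in> space M"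
    have "exp (- \<alpha> * t) * \<bar>g (X t \<omega>)\<bar> \<le> 1 * B"
      using * \<alpha> B X_in_E by (intro mult_mono) auto
    then show "\<bar>Z t \<omega>\<bar> \<le> B" by (simp add: abs_mult)
  qed
qed

text \<open>The stopped value is a function of the truncated hitting time and of the state there,
  which is \<open>z\<close> on the event of a hit and \<open>X t\<close> otherwise. This formula
  \<open>?S\<close> avoids evaluating the process at a random time.\<close>

lemma SZ_measurable_F:
  assumes "t \<ge> 0"
  shows "SZ t \<in> borel_measurable (F t)"
proof -
  let ?\<tau> = "\<lambda>\<omega>. real_of_ereal (min (ereal t) (hitting_time X z \<omega>))"
  have \<tau>: "?\<tau> \<in> borel_measurable (F t)"
  proof (rule borel_measurableI_le)
    fix a :: real
    \<comment> \<open>The level set is the whole space, empty, or the event of a hit up to time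
      \<open>a\<close>, respectively.\<close>
    consider "t \<le> a" | "a < 0" "a < t" | "0 \<le> a" "a < t" by linarith
    then show "{\<omega> \<in> space (F t). ?\<tau> \<omega> \<le> a} \<in> sets (F t)"
    proof cases
      case 1
      have "?\<tau> \<omega> \<le> a" for \<omega>
      proof -
        have "0 \<le> hitting_time X z \<omega>"
          unfolding hitting_time_def by (rule Inf_greatest) auto
        then show ?thesis using 1 assms by (cases "hitting_time X z \<omega>") (auto simp: min_def)
      qed
      then have "{\<omega> \<in> space (F t). ?\<tau> \<omega> \<le> a} = space (F t)" by blast
      then show ?thesis by (simp only: sets.top)
    next
      case 2
      then have "{\<omega> \<in> space (F t). ?\<tau> \<omega> \<le> a} = {}"
        using truncated_hitting_time_le_iff[OF path assms 2(2), of _ z] by (auto simp: hits_def)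
      then show ?thesis by (simp only: sets.empty_sets)
    next
      case 3
      then have "{\<omega> \<in> space (F t). ?\<tau> \<omega> \<le> a} = {\<omega>\<in>space M. hits X z a \<omega>}"
        using truncated_hitting_time_le_iff[OF path assms 3(2), of _ z] by auto
      then show ?thesis
        using sets_F_mono[OF _ hits_sets[OF 3(1)], of t z] 3(2) by (simp only: less_imp_le)
    qed
  qed
  have gX: "(\<lambda>\<omega>. g (X t \<omega>)) \<in> borel_measurable (F t)"
    by (rule measurable_compose[OF measurable_natural_filtration]) (use assms in auto)
  have hit: "Measurable.pred (F t) (\<lambda>\<omega>. hits X z t \<omega>)"
    using hits_sets[OF assms] by (simp add: pred_def)
  let ?S = "\<lambda>\<omega>. exp (- \<alpha> * ?\<tau> \<omega>) * (if hits X z t \<omega> then g z else g (X t \<omega>))"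
  have "?S \<in> borel_measurable (F t)"
    using \<tau> gX hit by measurable
  moreover have "SZ t \<omega> = ?S \<omega>"
    if w: "\<omega> \<in> space M" for \<omega>
  proof (cases "hits X z t \<omega>")
    case True
    then obtain T where "hitting_time X z \<omega> = ereal T" "T \<le> t" "X T \<omega> = z"
      using hitting_timeE[OF path[OF w]] by blast
    then show ?thesis using True by (simp add: stopped_process_def min_absorb2)
  next
    case False
    then have "min (ereal t) (hitting_time X z \<omega>) = ereal t"
      using hitting_time_le_iff[OF path[OF that], where t = t and z = z] by (auto simp: min_def)
    then show ?thesis using False by (simp add: stopped_process_def)
  qed
  ultimately show ?thesis
    using measurable_cong[of "F t" "SZ t" ?S borel] unfolding space_natural_filtration by blast
qed

lemma SZ_integrable:
  assumes "t \<ge> 0"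
  shows "integrable M (SZ t)"
proof -
  obtain B where B: "\<And>t \<omega>. t \<ge> 0 \<Longrightarrow> \<omega> \<in> space M \<Longrightarrow> \<bar>Z t \<omega>\<bar> \<le> B" using Z_bound by blast
  show ?thesis
  proof (rule integrable_bounded)
    show "SZ t \<in> borel_measurable M"
      using measurable_from_subalg[OF subalgebra_F SZ_measurable_F[OF assms]] .
    fix \<omega> assume w: "\<omega> \<in> space M"
    have "0 \<le> hitting_time X z \<omega>"
      unfolding hitting_time_def by (rule Inf_greatest) auto
    then have "0 \<le> real_of_ereal (min (ereal t) (hitting_time X z \<omega>))"
      using assms by (intro real_of_ereal_pos) auto
    then show "\<bar>SZ t \<omega>\<bar> \<le> B" unfolding stopped_process_def by (intro B w)
  qed
qed

text \<open>By the Markov property at \<open>r k\<close>, one step changes the mean on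
  \<open>A\<close> by \<open>exp (- \<alpha> * r k)\<close> times an integral of the semigroup
  increment over states other than \<open>z\<close>. That is at most \<open>e\<close> in absolute
  value, and \<open>k\<close> steps add up.\<close>

lemma stopped_grid_step:
  assumes s: "s \<ge> 0" and \<delta>: "\<delta> > 0" and A: "A \<in> sets (F s)"
    and small: "\<And>x. x \<in> E - {z} \<Longrightarrow> \<bar>exp (- \<alpha> * \<delta>) * (\<Sum>y\<in>E. p \<delta> x y * g y) - g x\<bar> \<le> e"
    and e: "e \<ge> 0"
  defines "r \<equiv> \<lambda>j. s + real j * \<delta>"
  defines "V \<equiv> \<lambda>k \<omega>. stopped_seq (\<lambda>j. X (r j) \<omega> = z) (\<lambda>j. Z (r j) \<omega>) k"
  shows "integrable M (V k)"
    and "\<bar>(\<integral>\<omega>. indicator A \<omega> * V k \<omega> \<partial>M) - (\<integral>\<omega>. indicator A \<omega> * V 0 \<omega> \<partial>M)\<bar> \<le> real k * e"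
proof -
  have r0: "r j \<ge> 0" and rs: "s \<le> r j" for j using s \<delta> by (auto simp: r_def)
  have r_mono: "r i \<le> r j" if "i \<le> j" for i j using that \<delta> by (simp add: r_def)
  have AM: "A \<in> sets M" using A by (rule sets_F)
  obtain B where B: "\<And>t \<omega>. t \<ge> 0 \<Longrightarrow> \<omega> \<in> space M \<Longrightarrow> \<bar>Z t \<omega>\<bar> \<le> B" using Z_bound by blast
  have Z_meas: "Z (r j) \<in> borel_measurable M" for j
    using measurable_of_X[OF r0] by measurable
  have D: "Measurable.pred M (\<lambda>\<omega>. X (r j) \<omega> = z)" for j
    using measurable_compose[OF X_measurable[OF r0[of j]], of "\<lambda>x. x = z"] by simp
  have V_meas: "V k \<in> borel_measurable M" for k
    unfolding V_def
  proof (induction k)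
    case (Suc k)
    have "Measurable.pred M (\<lambda>\<omega>. \<exists>j\<le>k. X (r j) \<omega> = z)" using D by measurable
    then show ?case unfolding stopped_seq.simps using Suc Z_meas by measurable
  qed (use Z_meas in simp)
  show V_int: "integrable M (V k)" for k
    unfolding V_def using V_meas[unfolded V_def] B[OF r0]
    by (intro integrable_bounded[of _ B] stopped_seq_abs_le) auto
  have step: "\<bar>(\<integral>\<omega>. indicator A \<omega> * V (Suc k) \<omega> \<partial>M) - (\<integral>\<omega>. indicator A \<omega> * V k \<omega> \<partial>M)\<bar> \<le> e" for k
  proof -
    \<comment> \<open>The part of \<open>A\<close> on which the k-th step is taken. It belongs to
      the past of \<open>r k\<close>, and the state at \<open>r k\<close> differs from
      \<open>z\<close> on it.\<close>
    define A' where "A' = A \<inter> (\<Inter>j\<in>{..k}. X (r j) -` (- {z}) \<inter> space (F (r k)))"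
    have A': "A' \<in> sets (F (r k))"
      unfolding A'_def
    proof (intro sets.Int[OF sets_F_mono[OF rs A]] sets.finite_INT)
      show "X (r j) -` (- {z}) \<inter> space (F (r k)) \<in> sets (F (r k))" if "j \<in> {..k}" for j
        using that by (intro measurable_sets[OF measurable_natural_filtration[OF r0 r_mono]]) auto
    qed auto
    then have A'M: "A' \<in> sets M" by (rule sets_F)
    have A'_iff: "\<omega> \<in> A' \<longleftrightarrow> \<omega> \<in> A \<and> (\<forall>j\<le>k. X (r j) \<omega> \<noteq> z)" if "\<omega> \<in> space M" for \<omega>
      using that by (auto simp: A'_def)
    let ?P = "\<lambda>x. \<Sum>y\<in>E. p \<delta> x y * g y"
    let ?a = "\<lambda>x. exp (- \<alpha> * \<delta>) * ?P x - g x"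
    have intZ: "integrable M (\<lambda>\<omega>. indicator A' \<omega> * u (X (r j) \<omega>))" for u :: "'s \<Rightarrow> real" and j
      by (intro integrable_indicator_mult A'M integrable_of_X r0)
    have "(\<integral>\<omega>. indicator A \<omega> * V (Suc k) \<omega> \<partial>M) - (\<integral>\<omega>. indicator A \<omega> * V k \<omega> \<partial>M) =
        (\<integral>\<omega>. indicator A \<omega> * V (Suc k) \<omega> - indicator A \<omega> * V k \<omega> \<partial>M)"
      by (intro Bochner_Integration.integral_diff[symmetric] integrable_indicator_mult AM V_int)
    also have "\<dots> = (\<integral>\<omega>. exp (- \<alpha> * r (Suc k)) * (indicator A' \<omega> * g (X (r (Suc k)) \<omega>)) -
        exp (- \<alpha> * r k) * (indicator A' \<omega> * g (X (r k) \<omega>)) \<partial>M)"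
    proof (rule Bochner_Integration.integral_cong[OF refl])
      fix \<omega> assume "\<omega> \<in> space M"
      then show "indicator A \<omega> * V (Suc k) \<omega> - indicator A \<omega> * V k \<omega> =
          exp (- \<alpha> * r (Suc k)) * (indicator A' \<omega> * g (X (r (Suc k)) \<omega>)) -
          exp (- \<alpha> * r k) * (indicator A' \<omega> * g (X (r k) \<omega>))"
        unfolding right_diff_distrib[symmetric] V_def stopped_seq_step
        by (auto simp: A'_iff indicator_def)
    qed
    also have "\<dots> = exp (- \<alpha> * r (Suc k)) * (\<integral>\<omega>. indicator A' \<omega> * g (X (r (Suc k)) \<omega>) \<partial>M) -
        exp (- \<alpha> * r k) * (\<integral>\<omega>. indicator A' \<omega> * g (X (r k) \<omega>) \<partial>M)"
      by (simp add: intZ)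
    also have "r (Suc k) = r k + \<delta>" by (simp add: r_def algebra_simps)
    also have "(\<integral>\<omega>. indicator A' \<omega> * g (X (r k + \<delta>) \<omega>) \<partial>M) =
        (\<integral>\<omega>. indicator A' \<omega> * ?P (X (r k) \<omega>) \<partial>M)"
      using \<delta> by (intro markov_integral r0 A') simp
    also have "exp (- \<alpha> * (r k + \<delta>)) * \<dots> -
        exp (- \<alpha> * r k) * (\<integral>\<omega>. indicator A' \<omega> * g (X (r k) \<omega>) \<partial>M) =
        exp (- \<alpha> * r k) * (exp (- \<alpha> * \<delta>) * (\<integral>\<omega>. indicator A' \<omega> * ?P (X (r k) \<omega>) \<partial>M) -
          (\<integral>\<omega>. indicator A' \<omega> * g (X (r k) \<omega>) \<partial>M))"
      by (simp add: algebra_simps flip: exp_add)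
    also have "exp (- \<alpha> * \<delta>) * (\<integral>\<omega>. indicator A' \<omega> * ?P (X (r k) \<omega>) \<partial>M) -
          (\<integral>\<omega>. indicator A' \<omega> * g (X (r k) \<omega>) \<partial>M) =
        (\<integral>\<omega>. exp (- \<alpha> * \<delta>) * (indicator A' \<omega> * ?P (X (r k) \<omega>)) - indicator A' \<omega> * g (X (r k) \<omega>) \<partial>M)"
      by (subst Bochner_Integration.integral_diff)
         (auto intro!: integrable_mult_right intZ[of ?P] intZ[of g])
    also have "\<dots> = (\<integral>\<omega>. indicator A' \<omega> * ?a (X (r k) \<omega>) \<partial>M)"
      by (simp add: algebra_simps)
    finally have eq: "(\<integral>\<omega>. indicator A \<omega> * V (Suc k) \<omega> \<partial>M) - (\<integral>\<omega>. indicator A \<omega> * V k \<omega> \<partial>M) =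
      exp (- \<alpha> * r k) * (\<integral>\<omega>. indicator A' \<omega> * ?a (X (r k) \<omega>) \<partial>M)" .
    have "\<bar>\<integral>\<omega>. indicator A' \<omega> * ?a (X (r k) \<omega>) \<partial>M\<bar> \<le> (\<integral>\<omega>. \<bar>indicator A' \<omega> * ?a (X (r k) \<omega>)\<bar> \<partial>M)"
      by (rule integral_abs_bound)
    also have "\<dots> \<le> (\<integral>\<omega>. e \<partial>M)"
    proof (rule integral_mono)
      show "integrable M (\<lambda>\<omega>. \<bar>indicator A' \<omega> * ?a (X (r k) \<omega>)\<bar>)"
        by (intro integrable_abs intZ[of ?a])
      \<comment> \<open>Outside \<open>A'\<close> the integrand is 0, which is at most
        \<open>e\<close> since e \<ge> 0.\<close>
      show "\<bar>indicator A' \<omega> * ?a (X (r k) \<omega>)\<bar> \<le> e" if "\<omega> \<in> space M" for \<omega>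
        using small[of "X (r k) \<omega>"] X_in_E[OF r0 that, of k] A'_iff[OF that] e
        by (auto simp: indicator_def)
    qed simp
    also have "\<dots> = e" by (simp add: prob_space)
    finally have "exp (- \<alpha> * r k) * \<bar>\<integral>\<omega>. indicator A' \<omega> * ?a (X (r k) \<omega>) \<partial>M\<bar> \<le> 1 * e"
      using \<alpha> r0[of k] by (intro mult_mono) auto
    then show ?thesis unfolding eq by (simp add: abs_mult)
  qed
  show "\<bar>(\<integral>\<omega>. indicator A \<omega> * V k \<omega> \<partial>M) - (\<integral>\<omega>. indicator A \<omega> * V 0 \<omega> \<partial>M)\<bar> \<le> real k * e"
  proof (induction k)
    case (Suc k)
    then show ?case using step[of k] by (simp add: algebra_simps)
  qed simp
qed

text \<open>An error of at most \<eta> times the mesh in each of n + 1 steps gives at most \<eta> (t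
  - s) in total, whatever n is. Dominated convergence replaces the grid values at \<open>t\<close>
  by \<open>SZ t\<close>, and \<eta> is arbitrary.\<close>

lemma SZ_integral_not_hits:
  assumes s: "0 \<le> s" "s < t" and A: "A \<in> sets (F s)" and no: "\<And>\<omega>. \<omega> \<in> A \<Longrightarrow> \<not> hits X z s \<omega>"
  shows "(\<integral>\<omega>. indicator A \<omega> * SZ t \<omega> \<partial>M) = (\<integral>\<omega>. indicator A \<omega> * SZ s \<omega> \<partial>M)"
proof -
  define \<delta> where "\<delta> = (\<lambda>n. (t - s) / real (Suc n))"
  define V where "V = (\<lambda>n k \<omega>. stopped_seq (\<lambda>j. X (s + real j * \<delta> n) \<omega> = z) (\<lambda>j. Z (s + real j * \<delta> n) \<omega>) k)"
  let ?L = "\<integral>\<omega>. indicator A \<omega> * SZ t \<omega> \<partial>M" and ?R = "\<integral>\<omega>. indicator A \<omega> * SZ s \<omega> \<partial>M"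
  have \<delta>: "\<delta> n > 0" for n using s by (simp add: \<delta>_def)
  have AM: "A \<in> sets M" using A by (rule sets_F)
  have \<delta>_lim: "filterlim \<delta> (at_right 0) sequentially"
    unfolding filterlim_at using \<delta> LIMSEQ_Suc[OF lim_const_over_n[of "t - s"]]
    by (auto simp: \<delta>_def)
  have V_int: "integrable M (V n k)" for n k
  proof -
    \<comment> \<open>For integrability any finite \<open>e\<close> will do; finiteness of
      \<open>E\<close> supplies one.\<close>
    have "\<exists>e\<ge>0. \<forall>x\<in>E - {z}. \<bar>exp (- \<alpha> * \<delta> n) * (\<Sum>y\<in>E. p (\<delta> n) x y * g y) - g x\<bar> \<le> e"
      using bounded_on_E[of "\<lambda>x. exp (- \<alpha> * \<delta> n) * (\<Sum>y\<in>E. p (\<delta> n) x y * g y) - g x"]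
      by (metis DiffD1)
    then show ?thesis
      unfolding V_def using stopped_grid_step(1)[OF s(1) \<delta> A] by blast
  qed
  obtain B where B: "\<And>t \<omega>. t \<ge> 0 \<Longrightarrow> \<omega> \<in> space M \<Longrightarrow> \<bar>Z t \<omega>\<bar> \<le> B" using Z_bound by blast
  have lim: "(\<lambda>n. \<integral>\<omega>. indicator A \<omega> * V n (Suc n) \<omega> \<partial>M) \<longlonglongrightarrow> ?L"
  proof (rule integral_dominated_convergence[where w = "\<lambda>_. \<bar>B\<bar>"])
    show "AE \<omega> in M. (\<lambda>n. indicator A \<omega> * V n (Suc n) \<omega>) \<longlonglongrightarrow> indicator A \<omega> * SZ t \<omega>"
    proof (rule AE_I2)
      fix \<omega> assume w: "\<omega> \<in> space M"
      show "(\<lambda>n. indicator A \<omega> * V n (Suc n) \<omega>) \<longlonglongrightarrow> indicator A \<omega> * SZ t \<omega>"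
      proof (cases "\<omega> \<in> A")
        case True
        show ?thesis
          unfolding V_def \<delta>_def
          by (intro tendsto_mult_left stopped_seq_tendsto path[OF w] s \<alpha> no True)
      qed simp
    qed
    show "AE \<omega> in M. norm (indicator A \<omega> * V n (Suc n) \<omega>) \<le> \<bar>B\<bar>" for n
    proof (rule AE_I2)
      fix \<omega> assume w: "\<omega> \<in> space M"
      have "\<bar>V n (Suc n) \<omega>\<bar> \<le> B"
        unfolding V_def using s \<delta>[of n] less_imp_le
        by (intro stopped_seq_abs_le B w) (auto intro!: add_nonneg_nonneg mult_nonneg_nonneg)
      then show "norm (indicator A \<omega> * V n (Suc n) \<omega>) \<le> \<bar>B\<bar>"
        by (auto simp: indicator_def)
    qed
  qed (use AM V_int SZ_integrable[of t] s in \<open>auto intro!: borel_measurable_times\<close>)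
  \<comment> \<open>The grid starts at \<open>s\<close>, and on \<open>A\<close> the process has not
    been stopped by then.\<close>
  have start: "(\<integral>\<omega>. indicator A \<omega> * V n 0 \<omega> \<partial>M) = ?R" for n
  proof (rule Bochner_Integration.integral_cong[OF refl])
    fix \<omega> assume w: "\<omega> \<in> space M"
    show "indicator A \<omega> * V n 0 \<omega> = indicator A \<omega> * SZ s \<omega>"
      using stopped_process_not_hits[where Z = Z, OF path[OF w] no]
      by (cases "\<omega> \<in> A") (simp_all add: V_def)
  qed
  have "\<bar>?L - ?R\<bar> \<le> \<eta> * (t - s)" if "\<eta> > 0" for \<eta>
  proof -
    \<comment> \<open>The eigenvalue equation makes the limit 0 in each state other than
      \<open>z\<close>, and finiteness of \<open>E\<close> makes the bound uniform.\<close>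
    have "eventually (\<lambda>h. \<forall>x\<in>E - {z}. \<bar>(exp (- \<alpha> * h) * (\<Sum>y\<in>E. p h x y * g y) - g x) / h\<bar> < \<eta>) (at_right 0)"
    proof (intro eventually_ball_finite ballI)
      fix x assume "x \<in> E - {z}"
      then have "((\<lambda>h. (exp (- \<alpha> * h) * (\<Sum>y\<in>E. p h x y * g y) - g x) / h) \<longlongrightarrow> 0) (at_right 0)"
        using semigroup_increment_tendsto[of x \<alpha> g] eigen[of x] by simp
      then show "eventually (\<lambda>h. \<bar>(exp (- \<alpha> * h) * (\<Sum>y\<in>E. p h x y * g y) - g x) / h\<bar> < \<eta>) (at_right 0)"
        using that by (auto dest: tendstoD simp: dist_real_def)
    qed (use finite_E in simp)
    from eventually_compose_filterlim[OF this \<delta>_lim]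
    have ev: "eventually (\<lambda>n. \<bar>(\<integral>\<omega>. indicator A \<omega> * V n (Suc n) \<omega> \<partial>M) - ?R\<bar> \<le> \<eta> * (t - s)) sequentially"
    proof eventually_elim
      case (elim n)
      have "\<bar>exp (- \<alpha> * \<delta> n) * (\<Sum>y\<in>E. p (\<delta> n) x y * g y) - g x\<bar> \<le> \<eta> * \<delta> n" if "x \<in> E - {z}" for x
      proof -
        have "\<bar>exp (- \<alpha> * \<delta> n) * (\<Sum>y\<in>E. p (\<delta> n) x y * g y) - g x\<bar> / \<delta> n < \<eta>"
          using elim that \<delta>[of n] by (auto simp: abs_divide)
        then show ?thesis using \<delta>[of n] by (simp add: pos_divide_less_eq)
      qed
      then have "\<bar>(\<integral>\<omega>. indicator A \<omega> * V n (Suc n) \<omega> \<partial>M) - (\<integral>\<omega>. indicator A \<omega> * V n 0 \<omega> \<partial>M)\<bar>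
          \<le> real (Suc n) * (\<eta> * \<delta> n)"
        unfolding V_def using \<delta>[of n] \<open>\<eta> > 0\<close> by (intro stopped_grid_step(2) s(1) A) auto
      also have "real (Suc n) * (\<eta> * \<delta> n) = \<eta> * (t - s)" by (simp add: \<delta>_def del: of_nat_Suc)
      finally show ?case unfolding start .
    qed
    have "(\<lambda>n. \<bar>(\<integral>\<omega>. indicator A \<omega> * V n (Suc n) \<omega> \<partial>M) - ?R\<bar>) \<longlonglongrightarrow> \<bar>?L - ?R\<bar>"
      by (intro tendsto_intros lim)
    then show ?thesis using ev by (rule tendsto_upperbound) simp
  qed
  \<comment> \<open>The choice of \<eta> that cancels the length of the interval.\<close>
  from this[of "e / (t - s)" for e] have "\<bar>?L - ?R\<bar> \<le> e" if "e > 0" for e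
    using that s by simp
  then have "\<bar>?L - ?R\<bar> \<le> 0" by (rule field_le_epsilon) simp
  then show ?thesis by simp
qed

theorem stopped_eigenfunction_martingale: "martingale M F SZ"
  unfolding martingale_def
proof (intro conjI allI impI)
  fix s t :: real assume st: "0 \<le> s \<and> s \<le> t"
  then have s0: "0 \<le> s" and t0: "0 \<le> t" by auto
  interpret sigma_finite_subalgebra M "F s" by (rule sigma_finite_F)
  show "AE \<omega> in M. real_cond_exp M (F s) (SZ t) \<omega> = SZ s \<omega>"
  proof (rule real_cond_exp_charact)
    fix A assume A: "A \<in> sets (F s)"
    \<comment> \<open>On \<open>H\<close> the process is already stopped at time \<open>s\<close>,
      so it is constant on [s, t]. The grid argument handles the complement.\<close>
    define H where "H = {\<omega>\<in>space M. hits X z s \<omega>}"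
    have H: "H \<in> sets (F s)" unfolding H_def by (rule hits_sets[OF s0])
    have AM: "A \<in> sets M" "A \<inter> H \<in> sets M" "A - H \<in> sets M" using A H by (auto intro!: sets_F)
    have split: "(\<integral>\<omega>. indicator A \<omega> * SZ u \<omega> \<partial>M) =
      (\<integral>\<omega>. indicator (A \<inter> H) \<omega> * SZ u \<omega> \<partial>M) + (\<integral>\<omega>. indicator (A - H) \<omega> * SZ u \<omega> \<partial>M)"
      if "u \<ge> 0" for u
    proof -
      have "(\<integral>\<omega>. indicator A \<omega> * SZ u \<omega> \<partial>M) =
          (\<integral>\<omega>. indicator (A \<inter> H) \<omega> * SZ u \<omega> + indicator (A - H) \<omega> * SZ u \<omega> \<partial>M)"
        by (rule Bochner_Integration.integral_cong) (auto simp: indicator_def)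
      also have "\<dots> = (\<integral>\<omega>. indicator (A \<inter> H) \<omega> * SZ u \<omega> \<partial>M) + (\<integral>\<omega>. indicator (A - H) \<omega> * SZ u \<omega> \<partial>M)"
        by (intro Bochner_Integration.integral_add integrable_indicator_mult AM SZ_integrable that)
      finally show ?thesis .
    qed
    have "(\<integral>\<omega>. indicator (A \<inter> H) \<omega> * SZ t \<omega> \<partial>M) = (\<integral>\<omega>. indicator (A \<inter> H) \<omega> * SZ s \<omega> \<partial>M)"
    proof (rule Bochner_Integration.integral_cong[OF refl])
      fix \<omega> assume w: "\<omega> \<in> space M"
      show "indicator (A \<inter> H) \<omega> * SZ t \<omega> = indicator (A \<inter> H) \<omega> * SZ s \<omega>"
        using stopped_process_hits_const[where Z = Z, OF path[OF w]] st
        by (cases "\<omega> \<in> A \<inter> H") (auto simp: H_def)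
    qed
    \<comment> \<open>The grid requires an interval of positive length; s = t is trivial.\<close>
    moreover have "(\<integral>\<omega>. indicator (A - H) \<omega> * SZ t \<omega> \<partial>M) = (\<integral>\<omega>. indicator (A - H) \<omega> * SZ s \<omega> \<partial>M)"
    proof (cases "s = t")
      case False
      show ?thesis
        by (rule SZ_integral_not_hits)
           (use False st A H sets.sets_into_space[OF A] in \<open>auto simp: H_def\<close>)
    qed simp
    ultimately show "(LINT \<omega>:A|M. SZ t \<omega>) = (LINT \<omega>:A|M. SZ s \<omega>)"
      using split[OF s0] split[OF t0] by (simp add: set_lebesgue_integral_def)
  qed (intro SZ_integrable SZ_measurable_F s0 t0)+
qed (rule filtration_natural_filtration subalgebra_F SZ_measurable_F SZ_integrable | assumption)+

end

end

section \<open>The Engset process\<close>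

text \<open>C < N makes the integer exponent N - C - 1 nonnegative, so \<open>powi\<close> is an
  ordinary power. The same holds for \<open>engset_d_eq\<close>.\<close>

lemma engset_b_eq:
  "C < N \<Longrightarrow> engset_b N C \<nu> \<mu> \<alpha> = \<nu> * weighted_integral (\<nu> / \<mu>) (\<alpha> + 1) C (N - Suc C)"
proof -
  assume "C < N"
  then have "int N - int C - 1 = int (N - Suc C)" by simp
  then show ?thesis
    unfolding engset_b_def weighted_integral_def by (simp only: power_int_of_nat add_diff_cancel_right')
qed

lemma engset_d_eq:
  "C < N \<Longrightarrow> engset_d N C \<nu> \<mu> \<alpha> = \<mu> * weighted_integral (\<mu> / \<nu>) (\<alpha> + 1) (N - Suc C) C"
proof -
  assume "C < N"
  then have "int N - int C - 1 = int (N - Suc C)" by simp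
  then show ?thesis
    unfolding engset_d_def weighted_integral_def by (simp only: power_int_of_nat add_diff_cancel_right')
qed

text \<open>\<open>engset_K\<close> as a function of the state, without its exponential factor. It
  is also evaluated at C + 1, a state that the process cannot reach.\<close>

definition engset_eigenfun :: "nat \<Rightarrow> nat \<Rightarrow> real \<Rightarrow> real \<Rightarrow> real \<Rightarrow> nat \<Rightarrow> real" where
  "engset_eigenfun N C \<nu> \<mu> \<alpha> x =
     engset_d N C \<nu> \<mu> \<alpha> * weighted_integral (\<nu> / \<mu>) \<alpha> x (N - x) +
     engset_b N C \<nu> \<mu> \<alpha> * weighted_integral (\<mu> / \<nu>) \<alpha> (N - x) x"

lemma engset_K_eq:
  "engset_K N C \<nu> \<mu> \<alpha> X = (\<lambda>t \<omega>. exp (- \<alpha> * t) * engset_eigenfun N C \<nu> \<mu> \<alpha> (X t \<omega>))"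
  by (intro ext) (simp add: engset_K_def engset_I_def engset_J_def engset_eigenfun_def
      weighted_integral_def distrib_left mult_ac)

text \<open>Let V and W be the integrals in \<open>engset_b\<close> and \<open>engset_d\<close>.
  From C to C + 1 the first integral falls by V/\<mu> and the second rises by W/\<nu>. With
  coefficients d = \<mu> W and b = \<nu> V the changes are -W V and V W, which cancel.\<close>

lemma engset_eigenfun_boundary:
  assumes "\<mu> > 0" "\<nu> > 0" "\<mu> + \<nu> = 1" "C < N" "\<alpha> > 0"
  shows "engset_eigenfun N C \<nu> \<mu> \<alpha> (C + 1) = engset_eigenfun N C \<nu> \<mu> \<alpha> C"
proof -
  obtain m where m: "N = Suc (C + m)" using assms(4) less_iff_Suc_add by auto
  have c: "1 + \<nu> / \<mu> = 1 / \<mu>" "1 + \<mu> / \<nu> = 1 / \<nu>" using assms by (simp_all add: field_simps)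
  have i: "weighted_integral (\<nu> / \<mu>) \<alpha> (Suc C) m =
      weighted_integral (\<nu> / \<mu>) \<alpha> C (Suc m) - 1 / \<mu> * weighted_integral (\<nu> / \<mu>) (\<alpha> + 1) C m"
    using weighted_integral_diff[OF assms(5), of "\<nu> / \<mu>" C m] unfolding c by linarith
  have j: "weighted_integral (\<mu> / \<nu>) \<alpha> m (Suc C) =
      weighted_integral (\<mu> / \<nu>) \<alpha> (Suc m) C + 1 / \<nu> * weighted_integral (\<mu> / \<nu>) (\<alpha> + 1) m C"
    using weighted_integral_diff[OF assms(5), of "\<mu> / \<nu>" m C] unfolding c by linarith
  have N: "N - (C + 1) = m" "N - C = Suc m" "N - Suc C = m" using m by auto
  show ?thesis
    unfolding engset_eigenfun_def engset_b_eq[OF assms(4)] engset_d_eq[OF assms(4)] N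
    using assms(1,2) by (simp add: i j field_simps)
qed

lemma engset_eigenfun_generator:
  assumes "\<mu> > 0" "\<nu> > 0" "\<mu> + \<nu> = 1" "C < N" "\<alpha> > 0" "x \<le> C" "x \<noteq> 0"
  defines "g \<equiv> engset_eigenfun N C \<nu> \<mu> \<alpha>"
  shows "(\<Sum>y\<in>{0..C} - {x}. engset_rate N C \<nu> \<mu> x y * (g y - g x)) = \<alpha> * g x"
proof -
  have x: "0 < x" "x < N" using assms by auto
  let ?i = "\<lambda>x. weighted_integral (\<nu> / \<mu>) \<alpha> x (N - x)"
  let ?j = "\<lambda>x. weighted_integral (\<mu> / \<nu>) \<alpha> (N - x) x"
  let ?b = "engset_b N C \<nu> \<mu> \<alpha>" and ?d = "engset_d N C \<nu> \<mu> \<alpha>"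
  have "\<mu> * real x * (g (x - 1) - g x) + \<nu> * (real N - real x) * (g (x + 1) - g x) =
      ?d * (\<mu> * real x * (?i (x - 1) - ?i x) + \<nu> * (real N - real x) * (?i (x + 1) - ?i x)) +
      ?b * (\<mu> * real x * (?j (x - 1) - ?j x) + \<nu> * (real N - real x) * (?j (x + 1) - ?j x))"
    unfolding g_def engset_eigenfun_def by (simp add: algebra_simps)
  also have "\<dots> = ?d * (\<alpha> * ?i x) + ?b * (\<alpha> * ?j x)"
    using weighted_integral_generator[OF assms(1,3,5) x]
      weighted_integral_generator_dual[OF assms(2,3,5) x] by simp
  also have "\<dots> = \<alpha> * g x"
    unfolding g_def engset_eigenfun_def by (simp add: algebra_simps)
  finally have full: "\<mu> * real x * (g (x - 1) - g x) +
      \<nu> * (real N - real x) * (g (x + 1) - g x) = \<alpha> * g x" .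
  have boundary: "g (C + 1) = g C"
    unfolding g_def by (rule engset_eigenfun_boundary[OF assms(1-5)])
  \<comment> \<open>Only the neighbours of \<open>x\<close> contribute; x > 0 ensures that
    \<open>x - 1\<close> differs from \<open>x\<close>. The upper neighbour lies in
    \<open>{0..C}\<close> exactly when x < C, as in \<open>engset_rate\<close>.\<close>
  have "(\<Sum>y\<in>{0..C} - {x}. engset_rate N C \<nu> \<mu> x y * (g y - g x)) =
      (\<Sum>y\<in>{0..C}. (if y = x - 1 then \<mu> * real x * (g (x - 1) - g x) else 0) +
        (if y = x + 1 then \<nu> * (real N - real x) * (g (x + 1) - g x) else 0))"
    using x by (intro sum.mono_neutral_cong_left) (auto simp: engset_rate_def)
  also have "\<dots> = \<mu> * real x * (g (x - 1) - g x) +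
      (if x < C then \<nu> * (real N - real x) * (g (x + 1) - g x) else 0)"
    using assms(6) le_trans[OF diff_le_self assms(6), of 1] by (simp add: sum.distrib)
  \<comment> \<open>For x = C the upward term that is added here is 0 by
    \<open>boundary\<close>.\<close>
  also have "\<dots> = \<mu> * real x * (g (x - 1) - g x) + \<nu> * (real N - real x) * (g (x + 1) - g x)"
    using assms(6) boundary by (cases "x = C") auto
  finally show ?thesis unfolding full .
qed

text \<open>The case C = N is excluded because the integral in \<open>engset_d\<close> then
  diverges, by \<open>engset_d_integrable_iff\<close>.\<close>

theorem proposition4:
  fixes M :: "'a measure" and X :: "real \<Rightarrow> 'a \<Rightarrow> nat"
    and N C :: nat and \<nu> \<mu> \<alpha> :: real
  assumes "prob_space M"
    and "\<mu> > 0" and "\<nu> > 0" and "\<mu> + \<nu> = 1"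
    and "1 \<le> C" and "C < N"
    and "engset_process M N C \<nu> \<mu> X"
    and "\<alpha> > 0"
  shows "martingale M (natural_filtration M X)
           (stopped_process (engset_K N C \<nu> \<mu> \<alpha> X) (hitting_time X 0))"
proof -
  obtain p where p: "transition_function {0..C} p"
    "has_transition_rates {0..C} p (engset_rate N C \<nu> \<mu>)"
    "\<forall>s\<ge>0. \<forall>h\<ge>0. \<forall>y\<in>{0..C}. AE \<omega> in M.
       real_cond_exp M (natural_filtration M X s) (\<lambda>\<omega>'. indicator {y} (X (s + h) \<omega>')) \<omega>
         = p h (X s \<omega>) y"
    using assms(7) unfolding engset_process_def markov_jump_process_def by blast
  interpret prob_space M by (rule assms(1))
  interpret finite_markov_jump M "{0..C}" "engset_rate N C \<nu> \<mu>" X p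
    using assms(7) p
    by unfold_locales (auto simp: engset_process_def markov_jump_process_def right_cont_path_def)
  \<comment> \<open>The choice z = 0 matches the eigenvalue equation, which was shown for the states
    1, ..., C.\<close>
  show ?thesis
    unfolding engset_K_eq
    by (rule stopped_eigenfunction_martingale)
       (use assms engset_eigenfun_generator[OF assms(2-4,6,8)] in auto)
qed

end
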